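(* Let $l$ and $n$ be positive integers. If $v_p(n+1)\geq\log_p(l+1)$ for every prime $p$ such that $p\leq l$ and $p\mid n+1$, then \[ C_l(n)=\frac{1}{(n+1)^l}\cdot\frac{((l+1)n)!}{(n!)^{l+1}} \] is an integer.
   Context: $v_p$ denotes the $p$-adic valuation. *)

theory Defs
  imports Complex_Main "HOL-Computational_Algebra.Primes"
begin

definition C :: "nat \<Rightarrow> nat \<Rightarrow> rat" where
  "C l n = 1 / (of_nat (n + 1)) ^ l * (fact ((l + 1) * n) / (fact n) ^ (l + 1))"

end

theory Submission
  imports Defs
begin

text \<open>
  Put \<open>N = n + 1\<close> and \<open>v = v\<^sub>p(N)\<close>. Primes not dividing \<open>N\<close> are harmless, because the
  multinomial coefficient is an integer. If \<open>p\<close> divides \<open>N\<close>, then \<open>l < p ^ v\<close> (by hypothesis, or trivially if \<open>p > l\<close>), so that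
  \<open>v\<^sub>p((l + 1) N - j) = v\<^sub>p(j)\<close> for \<open>0 < j \<le> l\<close>. Removing the top \<open>l + 1\<close> factors of
  \<open>((l + 1) N)!\<close> therefore gives
  \<open>v\<^sub>p(((l + 1) N)!) = v\<^sub>p(((l + 1) n)!) + v + v\<^sub>p((l + 1)!)\<close>, hence \<open>C l n\<close> has the same \<open>p\<close>-adic
  valuation as \<open>((l + 1) N)! / (N! ^ (l + 1) (l + 1)!)\<close>, which is an integer (it counts the
  partitions of a set with \<open>(l + 1) N\<close> elements into \<open>l + 1\<close> blocks of size \<open>N\<close>).
\<close>

lemma fact_power_dvd_fact: "(fact n ^ k :: nat) dvd fact (k * n)"
proof (induction k)
  case (Suc k)
  have "(fact n * fact n ^ k :: nat) dvd fact n * fact (k * n)"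
    using Suc by (rule mult_dvd_mono[OF dvd_refl])
  also have "\<dots> dvd fact (n + k * n)"
    by (rule fact_fact_dvd_fact)
  finally show ?case by simp
qed simp

text \<open>Fixing one element of the block to be chosen yields the extra \<open>fact k\<close>:
  once \<open>Suc k * N\<close> is split off \<open>fact (Suc k * N)\<close>, the rest is divisible
  by \<open>fact (N - 1) * fact (k * N)\<close>.\<close>

lemma fact_power_mult_fact_dvd_fact:
  assumes "N > 0"
  shows "(fact N ^ k * fact k :: nat) dvd fact (k * N)"
proof (induction k)
  case (Suc k)
  obtain m where N: "N = Suc m"
    using assms gr0_implies_Suc by blast
  have top: "(fact (Suc k * N) :: nat) = Suc k * N * fact (m + k * N)"
    by (simp add: N add_ac)
  have "(fact m * (fact N ^ k * fact k) :: nat) dvd fact m * fact (k * N)"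
    using Suc by (rule mult_dvd_mono[OF dvd_refl])
  also have "\<dots> dvd fact (m + k * N)"
    by (rule fact_fact_dvd_fact)
  finally have "Suc k * N * (fact m * (fact N ^ k * fact k)) dvd fact (Suc k * N)"
    unfolding top by (rule mult_dvd_mono[OF dvd_refl])
  moreover have "Suc k * N * (fact m * (fact N ^ k * fact k)) = (fact N ^ Suc k * fact (Suc k) :: nat)"
    by (simp add: N algebra_simps)
  ultimately show ?case by (simp only:)
qed simp

text \<open>As \<open>k < p ^ v\<close>, the valuation j of \<open>k\<close> is below
  \<open>v\<close>, so \<open>p ^ (j + 1)\<close> divides \<open>M\<close> and cannot divide
  \<open>M - k\<close> without dividing \<open>k\<close>.\<close>

lemma multiplicity_diff_eq:
  fixes p k M v :: nat
  assumes "prime p" "p ^ v dvd M" "0 < k" "k < p ^ v" "k \<le> M"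
  shows "multiplicity p (M - k) = multiplicity p k"
proof (rule multiplicity_eqI)
  let ?j = "multiplicity p k"
  have nu: "\<not> is_unit p" using assms(1) by auto
  have "\<not> p ^ v dvd k"
    using assms(3,4) nat_dvd_not_less by blast
  hence "?j < v"
    by (meson multiplicity_dvd' not_le)
  hence j: "p ^ ?j dvd M" "p ^ Suc ?j dvd M"
    using assms(2) by (meson power_le_dvd Suc_leI less_imp_le)+
  show "p ^ ?j dvd M - k"
    using j(1) by (intro dvd_diff_nat multiplicity_dvd)
  show "\<not> p ^ Suc ?j dvd M - k"
  proof
    assume "p ^ Suc ?j dvd M - k"
    hence "p ^ Suc ?j dvd k"
      using j(2) assms(5) by (metis dvd_diff_nat diff_diff_cancel)
    thus False
      using assms(3) nu multiplicity_geI[of k p "Suc ?j"] by auto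
  qed
qed

text \<open>Besides \<open>M\<close>, the removed factors are \<open>M - i\<close> with
  \<open>0 < i \<le> k\<close>; each has the valuation of \<open>i\<close>, which adds up to that of
  \<open>fact k\<close>.\<close>

lemma multiplicity_fact_remove_top:
  fixes p k M v :: nat
  assumes "prime p" "p ^ v dvd M" "k < p ^ v" "k < M"
  shows "multiplicity p (fact M :: nat) =
    multiplicity p (fact (M - Suc k) :: nat) + multiplicity p M + multiplicity p (fact k :: nat)"
  using assms(3,4)
proof (induction k)
  case 0
  then obtain m where "M = Suc m" using gr0_implies_Suc by blast
  thus ?case
    using assms(1) by (simp add: prime_elem_multiplicity_mult_distrib del: mult_Suc)
next
  case (Suc k)
  have top: "(fact (M - Suc k) :: nat) = (M - Suc k) * fact (M - Suc (Suc k))"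
    using Suc.prems by (simp add: fact_reduce)
  have "multiplicity p (fact (M - Suc k) :: nat) =
      multiplicity p (Suc k) + multiplicity p (fact (M - Suc (Suc k)) :: nat)"
    unfolding top using Suc.prems assms(1) multiplicity_diff_eq[OF assms(1,2), of "Suc k"]
    by (simp add: prime_elem_multiplicity_mult_distrib)
  moreover have "multiplicity p (fact (Suc k) :: nat) =
      multiplicity p (Suc k) + multiplicity p (fact k :: nat)"
    using assms(1) by (simp add: prime_elem_multiplicity_mult_distrib del: mult_Suc)
  ultimately show ?case
    using Suc by simp
qed

lemma power_mult_fact_power_dvd_fact:
  fixes l n :: nat
  assumes "\<And>p :: nat. prime p \<Longrightarrow> p dvd n + 1 \<Longrightarrow> l < p ^ multiplicity p (n + 1)"
  shows "(n + 1) ^ l * fact n ^ (l + 1) dvd (fact ((l + 1) * n) :: nat)"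
proof (rule multiplicity_le_imp_dvd)
  fix p :: nat
  assume p: "prime p"
  let ?v = "multiplicity p" and ?N = "n + 1"
  let ?x = "?N ^ l * fact n ^ (l + 1) :: nat"
  note mult = prime_elem_multiplicity_mult_distrib[OF prime_imp_prime_elem[OF p]]
  show "?v ?x \<le> ?v (fact ((l + 1) * n) :: nat)"
  proof (cases "p dvd ?N")
    case False
    hence "?v ?x = ?v (fact n ^ (l + 1) :: nat)"
      using p by (simp add: mult prime_elem_multiplicity_power_distrib not_dvd_imp_multiplicity_0)
    also have "\<dots> \<le> ?v (fact ((l + 1) * n) :: nat)"
      by (intro dvd_imp_multiplicity_le fact_power_dvd_fact) simp
    finally show ?thesis .
  next
    case True
    let ?M = "(l + 1) * ?N"
    have "?v (fact ?M :: nat) =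
        ?v (fact (?M - Suc l) :: nat) + ?v ?M + ?v (fact l :: nat)"
      by (intro multiplicity_fact_remove_top[OF p _ assms[OF p True]] dvd_mult multiplicity_dvd)
        simp
    also have "?M - Suc l = (l + 1) * n"
      by (simp add: algebra_simps)
    also have "?v ?M = ?v (l + 1) + ?v ?N"
      by (intro mult) auto
    \<comment> \<open>The factor \<open>l + 1\<close> of \<open>?M\<close> completes
      \<open>fact l\<close> to \<open>fact (l + 1)\<close>.\<close>
    finally have "?v (fact ?M :: nat) =
        ?v (fact ((l + 1) * n) :: nat) + ?v ?N + ?v (fact (l + 1) :: nat)"
      using mult[of "l + 1" "fact l"] by simp
    moreover have "?v (fact ?N ^ (l + 1) * fact (l + 1) :: nat) \<le> ?v (fact ?M :: nat)"
      by (intro dvd_imp_multiplicity_le fact_power_mult_fact_dvd_fact) auto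
    moreover have "?v (fact ?N ^ (l + 1) * fact (l + 1) :: nat) =
        ?v (fact ?N ^ (l + 1) :: nat) + ?v (fact (l + 1) :: nat)"
      by (intro mult) auto
    \<comment> \<open>The one factor \<open>?N\<close> in excess of \<open>?x\<close> cancels the
      \<open>?v ?N\<close> coming from \<open>?M\<close>.\<close>
    moreover have "?v (fact ?N ^ (l + 1) :: nat) = ?v ?x + ?v ?N"
    proof -
      have "(fact ?N :: nat) = ?N * fact n" by simp
      hence "(fact ?N ^ (l + 1) :: nat) = ?x * ?N"
        by (simp only: power_mult_distrib power_add power_one_right mult_ac)
      thus ?thesis
        using mult[of ?x ?N] by (simp only:) simp
    qed
    ultimately show ?thesis by linarith
  qed
qed simp

theorem theorem8:
  fixes l n :: nat
  assumes "l > 0" and "n > 0"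
    and "\<And>p :: nat. prime p \<Longrightarrow> p \<le> l \<Longrightarrow> p dvd n + 1 \<Longrightarrow>
           real (multiplicity p (n + 1)) \<ge> log (real p) (real (l + 1))"
  shows "C l n \<in> \<int>"
proof -
  have "l < p ^ multiplicity p (n + 1)" if p: "prime p" "p dvd n + 1" for p :: nat
  proof (cases "p \<le> l")
    case True
    have p1: "real p > 1"
      using prime_gt_1_nat[OF p(1)] by simp
    have "real (l + 1) \<le> real p powr real (multiplicity p (n + 1))"
      using assms(3)[OF p(1) True p(2)] p1 by (subst (asm) log_le_iff) auto
    also have "\<dots> = real (p ^ multiplicity p (n + 1))"
      using p1 by (simp add: powr_realpow)
    finally show ?thesis
      unfolding of_nat_le_iff by simp
  next
    case False
    \<comment> \<open>Here \<open>p > l\<close>, so exponent 1 already suffices.\<close>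
    have "p ^ 1 \<le> p ^ multiplicity p (n + 1)"
      using p prime_ge_1_nat[OF p(1)] by (intro power_increasing multiplicity_geI) auto
    thus ?thesis using False by simp
  qed
  then obtain c where c: "(fact ((l + 1) * n) :: nat) = (n + 1) ^ l * fact n ^ (l + 1) * c"
    using power_mult_fact_power_dvd_fact by (meson dvdE)
  have "(fact ((l + 1) * n) :: rat) = of_nat (fact ((l + 1) * n))"
    by (simp only: of_nat_fact)
  also have "\<dots> = of_nat (n + 1) ^ l * fact n ^ (l + 1) * of_nat c"
    unfolding c by (simp only: of_nat_mult of_nat_power of_nat_fact)
  finally have fact_eq:
    "(fact ((l + 1) * n) :: rat) = of_nat (n + 1) ^ l * fact n ^ (l + 1) * of_nat c" .
  have "(of_nat (n + 1) :: rat) \<noteq> 0"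
    by (simp only: of_nat_eq_0_iff)
  hence "C l n = of_nat c"
    unfolding C_def fact_eq by simp
  thus ?thesis by simp
qed

end
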